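(* Let $(X,d,\ll,\leq,\tau)$ be a quasi-strongly causal, intrinsic Lorentzian pre-length space and let $\Omega,\Omega'\colon X\to(0,+\infty)$ be continuous functions such that $\tau_\Omega=\tau_{\Omega'}$. Then for every point $p\in X$ for which there exists a sequence $(p_n)_n$ in $I^+(p)$ with $p_n\to p$ and $\tau(p,p_n)<+\infty$, we have $\Omega(p)=\Omega'(p)$. Analogously, $\Omega(p)=\Omega'(p)$ for every $p\in X$ for which there exists a sequence $(p_n)_n$ in $I^-(p)$ with $p_n\to p$ and $\tau(p_n,p)<+\infty$.
   Context: A Lorentzian pre-length space $(X,d,\ll,\leq,\tau)$ consists of a set $X$, a metric $d$ on $X$, two transitive relations $\ll,\leq$ on $X$ with $\leq$ reflexive and $\ll$ contained in $\leq$, and a map $\tau\colon X\times X\to[0,+\infty]$ which is lower semicontinuous with respect to the topology of $d$, satisfies $\tau(x,z)\geq\tau(x,y)+\tau(y,z)$ whenever $x\leq y\leq z$, satisfies $\tau(x,y)=0$ if $x\not\leq y$, and satisfies $\tau(x,y)>0$ if and only if $x\ll y$. Put $I^+(p)=\{z:p\ll z\}$ and $I^-(p)=\{z:z\ll p\}$. A curve is a continuous map from an interval into $X$. A non-constant curve $\gamma\colon I\to X$ is causal if $\gamma(t)\leq\gamma(s)$ for all $t<s$ in $I$. A causal curve from $x$ to $y$ is one defined on a compact interval, starting at $x$ and ending at $y$. For a continuous $\omega\colon X\to(0,+\infty)$ and a causal curve $\gamma\colon[a,b]\to X$ put $$L_\omega^\tau(\gamma):=\inf\Big\{\sum_{i=0}^{m-1}\max_{t\in[t_i,t_{i+1}]}\omega(\gamma(t))\,\tau(\gamma(t_i),\gamma(t_{i+1}))\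 :\ a=t_0<\dots<t_m=b\Big\},$$ $L^\tau:=L^\tau_1$, and $$\tau_\omega(x,y):=\sup\big(\{0\}\cup\{L_\omega^\tau(\gamma):\gamma\text{ a causal curve from }x\text{ to }y\}\big).$$ The space is intrinsic if $\tau(x,y)=\sup(\{0\}\cup\{L^\tau(\gamma):\gamma\text{ a causal curve from }x\text{ to }y\})$ for all $x,y\in X$. It is quasi-strongly causal if for every $x\in X$ and every neighbourhood $U$ of $x$ there is a neighbourhood $V\subseteq U$ of $x$ such that every causal curve $\gamma\colon[a,b]\to X$ with $\gamma(a),\gamma(b)\in V$ satisfies $\gamma([a,b])\subseteq U$. *)

theory Defs
  imports "HOL-Analysis.Analysis"
begin

text \<open>
  The underlying metric space \<open>(X, d)\<close> is an arbitrary type of class \<^class>\<open>metric_space\<close>,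
  with \<open>d\<close> the function \<^const>\<open>dist\<close>. The relations \<open>\<lless>\<close> and \<open>\<le>\<close> are \<open>chron\<close> and \<open>caus\<close>.
\<close>

text \<open>Lower semicontinuity with respect to the topology of the domain: strict superlevel sets are open.\<close>

definition lower_semicontinuous :: "('b::topological_space \<Rightarrow> ennreal) \<Rightarrow> bool"
  where "lower_semicontinuous f \<longleftrightarrow> (\<forall>c. open {z. c < f z})"

locale lorentzian_pre_length_space =
  fixes chron caus :: "'a::metric_space \<Rightarrow> 'a \<Rightarrow> bool"
    and \<tau> :: "'a \<Rightarrow> 'a \<Rightarrow> ennreal"
  assumes chron_trans: "transp chron"
    and caus_trans: "transp caus"
    and caus_refl: "reflp caus"
    and chron_imp_caus: "chron x y \<Longrightarrow> caus x y"
    and tau_lsc: "lower_semicontinuous (\<lambda>(x, y). \<tau> x y)"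
    and reverse_triangle: "caus x y \<Longrightarrow> caus y z \<Longrightarrow> \<tau> x y + \<tau> y z \<le> \<tau> x z"
    and tau_eq_0: "\<not> caus x y \<Longrightarrow> \<tau> x y = 0"
    and tau_pos_iff: "0 < \<tau> x y \<longleftrightarrow> chron x y"

definition chron_future :: "('a \<Rightarrow> 'a \<Rightarrow> bool) \<Rightarrow> 'a \<Rightarrow> 'a set"
  where "chron_future chron p = {z. chron p z}"

definition chron_past :: "('a \<Rightarrow> 'a \<Rightarrow> bool) \<Rightarrow> 'a \<Rightarrow> 'a set"
  where "chron_past chron p = {z. chron z p}"

text \<open>
  Curves are total functions on the reals; only the values on the domain interval matter.
  Only curves on compact intervals are needed. Non-constancy forces \<open>a < b\<close>.
\<close>

definition causal_curve ::
    "('a::topological_space \<Rightarrow> 'a \<Rightarrow> bool) \<Rightarrow> real \<Rightarrow> real \<Rightarrow> (real \<Rightarrow> 'a) \<Rightarrow> bool"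
  where "causal_curve caus a b \<gamma> \<longleftrightarrow>
    continuous_on {a..b} \<gamma> \<and>
    \<not> \<gamma> constant_on {a..b} \<and>
    (\<forall>t\<in>{a..b}. \<forall>s\<in>{a..b}. t < s \<longrightarrow> caus (\<gamma> t) (\<gamma> s))"

definition is_partition :: "real \<Rightarrow> real \<Rightarrow> nat \<Rightarrow> (nat \<Rightarrow> real) \<Rightarrow> bool"
  where "is_partition a b m t \<longleftrightarrow> t 0 = a \<and> t m = b \<and> (\<forall>i<m. t i < t (Suc i))"

text \<open>
  The maximum of \<open>\<omega> \<circ> \<gamma>\<close> over a subinterval is written as a supremum, because \<^const>\<open>Max\<close> is
  only meaningful for finite sets; it is attained for continuous \<open>\<omega>\<close> and \<open>\<gamma>\<close>, as shown in
  \<open>SUP_weight_attained\<close>.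
\<close>

definition weighted_length ::
    "('a \<Rightarrow> 'a \<Rightarrow> ennreal) \<Rightarrow> ('a \<Rightarrow> real) \<Rightarrow> real \<Rightarrow> real \<Rightarrow> (real \<Rightarrow> 'a) \<Rightarrow> ennreal"
  where "weighted_length \<tau> \<omega> a b \<gamma> =
    Inf {(\<Sum>i<m. (SUP s\<in>{t i..t (Suc i)}. ennreal (\<omega> (\<gamma> s))) * \<tau> (\<gamma> (t i)) (\<gamma> (t (Suc i)))) | m t.
         is_partition a b m t}"

lemma SUP_weight_attained:
  fixes \<omega> :: "'a::topological_space \<Rightarrow> real"
    and \<gamma> :: "real \<Rightarrow> 'a"
  assumes "u \<le> v" "continuous_on {u..v} \<gamma>" "continuous_on UNIV \<omega>"
  shows "\<exists>s\<in>{u..v}. (\<forall>r\<in>{u..v}. \<omega> (\<gamma> r) \<le> \<omega> (\<gamma> s)) \<and>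
    (SUP r\<in>{u..v}. ennreal (\<omega> (\<gamma> r))) = ennreal (\<omega> (\<gamma> s))"
proof -
  have "continuous_on {u..v} (\<lambda>r. \<omega> (\<gamma> r))"
    using continuous_on_compose2[OF assms(3,2)] by simp
  then obtain s where s: "s \<in> {u..v}" "\<forall>r\<in>{u..v}. \<omega> (\<gamma> r) \<le> \<omega> (\<gamma> s)"
    using continuous_attains_sup[of "{u..v}" "\<lambda>r. \<omega> (\<gamma> r)"] assms(1) by auto
  have "(SUP r\<in>{u..v}. ennreal (\<omega> (\<gamma> r))) = ennreal (\<omega> (\<gamma> s))"
    using s by (intro antisym SUP_least SUP_upper) (auto intro: ennreal_leI)
  with s show ?thesis by blast
qed

definition tau_length :: "('a \<Rightarrow> 'a \<Rightarrow> ennreal) \<Rightarrow> real \<Rightarrow> real \<Rightarrow> (real \<Rightarrow> 'a) \<Rightarrow> ennreal"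
  where "tau_length \<tau> = weighted_length \<tau> (\<lambda>_. 1)"

definition tau_weighted ::
    "('a::topological_space \<Rightarrow> 'a \<Rightarrow> bool) \<Rightarrow> ('a \<Rightarrow> 'a \<Rightarrow> ennreal) \<Rightarrow> ('a \<Rightarrow> real) \<Rightarrow> 'a \<Rightarrow> 'a \<Rightarrow> ennreal"
  where "tau_weighted caus \<tau> \<omega> x y =
    Sup ({0} \<union> {weighted_length \<tau> \<omega> a b \<gamma> | a b \<gamma>.
                 causal_curve caus a b \<gamma> \<and> \<gamma> a = x \<and> \<gamma> b = y})"

definition intrinsic ::
    "('a::topological_space \<Rightarrow> 'a \<Rightarrow> bool) \<Rightarrow> ('a \<Rightarrow> 'a \<Rightarrow> ennreal) \<Rightarrow> bool"
  where "intrinsic caus \<tau> \<longleftrightarrow>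
    (\<forall>x y. \<tau> x y = Sup ({0} \<union> {tau_length \<tau> a b \<gamma> | a b \<gamma>.
                                  causal_curve caus a b \<gamma> \<and> \<gamma> a = x \<and> \<gamma> b = y}))"

text \<open>A neighbourhood of \<open>x\<close> is a set, not necessarily open, containing \<open>x\<close> in its interior.\<close>

definition quasi_strongly_causal :: "('a::topological_space \<Rightarrow> 'a \<Rightarrow> bool) \<Rightarrow> bool"
  where "quasi_strongly_causal caus \<longleftrightarrow>
    (\<forall>x U. x \<in> interior U \<longrightarrow>
      (\<exists>V\<subseteq>U. x \<in> interior V \<and>
        (\<forall>a b \<gamma>. causal_curve caus a b \<gamma> \<and> \<gamma> a \<in> V \<and> \<gamma> b \<in> V \<longrightarrow> \<gamma> ` {a..b} \<subseteq> U)))"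

end

theory Submission
  imports Defs
begin

text \<open>
  The idea is that the weighted time separation near \<open>p\<close> remembers the value of the weight at \<open>p\<close>.
  If a weight takes values in \<open>[c, C]\<close>, where \<open>0 < c\<close>, along every causal curve from \<open>x\<close> to \<open>y\<close>, then its weighted
  lengths lie between \<open>c\<close> and \<open>C\<close> times the unweighted ones. Taking suprema over curves,
  intrinsicness turns this into \<open>c * \<tau> x y \<le> \<tau>\<^sub>\<omega> x y \<le> C * \<tau> x y\<close>.

  Suppose now that \<open>\<Omega> p < C < c < \<Omega>' p\<close>. By continuity \<open>\<Omega> < C\<close> and \<open>c < \<Omega>'\<close> on a neighbourhood
  \<open>U\<close> of \<open>p\<close>, and by quasi-strong causality the causal curves whose endpoints lie in a smaller
  neighbourhood \<open>V\<close> stay in \<open>U\<close>. For \<open>x, y \<in> V\<close>, equality of the two weighted time separations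
  gives \<open>c * \<tau> x y \<le> C * \<tau> x y\<close>, so that \<open>\<tau> x y\<close> is \<open>0\<close> or \<open>\<infinity>\<close>
  (\<open>tau_degenerate_near_weight_less\<close>). A sequence as in the theorem produces a pair in \<open>V\<close>,
  one point of which is \<open>p\<close>, whose time separation is positive and finite; by symmetry in
  \<open>\<Omega>\<close> and \<open>\<Omega>'\<close> the two weights agree at \<open>p\<close>.
\<close>

text \<open>
  Along a fixed partition the inequality of the weights passes to the suprema over its intervals and
  hence to the sums. The factor stands on the side of the smaller weight so that it never has to
  be moved through the infimum over partitions.
\<close>

lemma weighted_length_mult_le:
  fixes \<omega> \<omega>' :: "'a \<Rightarrow> real"
  assumes k: "0 \<le> k"
    and le: "\<And>s. s \<in> {a..b} \<Longrightarrow> k * \<omega> (\<gamma> s) \<le> \<omega>' (\<gamma> s)"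
  shows "ennreal k * weighted_length \<tau> \<omega> a b \<gamma> \<le> weighted_length \<tau> \<omega>' a b \<gamma>"
proof -
  let ?S = "\<lambda>w m t. \<Sum>i<m. (SUP s\<in>{t i..t (Suc i)}. ennreal (w (\<gamma> s))) * \<tau> (\<gamma> (t i)) (\<gamma> (t (Suc i)))"
  have "ennreal k * weighted_length \<tau> \<omega> a b \<gamma> \<le> ?S \<omega>' m t" if part: "is_partition a b m t" for m t
  proof -
    have mono: "t i \<le> t j" if "i \<le> j" "j \<le> m" for i j
      using that
    proof (induction j rule: dec_induct)
      case (step j)
      then show ?case
        using part unfolding is_partition_def by (metis Suc_leD Suc_le_lessD less_eq_real_def order_trans)
    qed simp
    have sub: "{t i..t (Suc i)} \<subseteq> {a..b}" if "i < m" for i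
      using mono[of 0 i] mono[of "Suc i" m] that part by (auto simp: is_partition_def)
    have "weighted_length \<tau> \<omega> a b \<gamma> \<le> ?S \<omega> m t"
      unfolding weighted_length_def using part by (intro Inf_lower) blast
    then have "ennreal k * weighted_length \<tau> \<omega> a b \<gamma> \<le> ennreal k * ?S \<omega> m t"
      by (rule mult_left_mono) simp
    also have "\<dots> = (\<Sum>i<m. (SUP s\<in>{t i..t (Suc i)}. ennreal k * ennreal (\<omega> (\<gamma> s)))
                        * \<tau> (\<gamma> (t i)) (\<gamma> (t (Suc i))))"
      by (simp add: sum_distrib_left SUP_mult_left_ennreal[symmetric] mult.assoc)
    also have "\<dots> \<le> ?S \<omega>' m t"
    proof (intro sum_mono mult_right_mono)
      fix i
      show "(SUP s\<in>{t i..t (Suc i)}. ennreal k * ennreal (\<omega> (\<gamma> s)))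
              \<le> (SUP s\<in>{t i..t (Suc i)}. ennreal (\<omega>' (\<gamma> s)))" if "i \<in> {..<m}"
        using subsetD[OF sub[of i]] that k
        by (intro SUP_subset_mono order_refl)
          (simp add: ennreal_mult'[symmetric] ennreal_leI le)
    qed simp
    finally show ?thesis .
  qed
  then show ?thesis
    unfolding weighted_length_def[of \<tau> \<omega>'] by (intro Inf_greatest) blast
qed

lemma tau_weighted_mult_le:
  fixes \<omega> \<omega>' :: "'a::topological_space \<Rightarrow> real"
  assumes "0 \<le> k"
    and le: "\<And>a b \<gamma> s. \<lbrakk>causal_curve caus a b \<gamma>; \<gamma> a = x; \<gamma> b = y; s \<in> {a..b}\<rbrakk>
               \<Longrightarrow> k * \<omega> (\<gamma> s) \<le> \<omega>' (\<gamma> s)"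
  shows "ennreal k * tau_weighted caus \<tau> \<omega> x y \<le> tau_weighted caus \<tau> \<omega>' x y"
proof -
  have "ennreal k * weighted_length \<tau> \<omega> a b \<gamma> \<le> tau_weighted caus \<tau> \<omega>' x y"
    if c: "causal_curve caus a b \<gamma>" "\<gamma> a = x" "\<gamma> b = y" for a b \<gamma>
  proof -
    have "ennreal k * weighted_length \<tau> \<omega> a b \<gamma> \<le> weighted_length \<tau> \<omega>' a b \<gamma>"
      using weighted_length_mult_le[of k a b \<omega> \<gamma> \<omega>' \<tau>] assms c by blast
    also have "\<dots> \<le> tau_weighted caus \<tau> \<omega>' x y"
      unfolding tau_weighted_def using c by (intro Sup_upper) blast
    finally show ?thesis .
  qed
  then show ?thesis
    unfolding tau_weighted_def[of caus \<tau> \<omega>]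
    by (subst SUP_mult_left_ennreal[where f = "\<lambda>z. z", simplified]) (auto intro!: SUP_least)
qed

lemma intrinsic_iff_tau_weighted_one: "intrinsic caus \<tau> \<longleftrightarrow> tau_weighted caus \<tau> (\<lambda>_. 1) = \<tau>"
  by (auto simp: intrinsic_def tau_weighted_def tau_length_def fun_eq_iff)

text \<open>
  The local comparison at the heart of the argument: a strict inequality of the weights persists,
  with a gap, along all causal curves between points close to \<open>p\<close>, which forces
  \<open>c * \<tau> x y \<le> C * \<tau> x y\<close> for some \<open>0 < C < c\<close>.
\<close>

lemma tau_degenerate_near_weight_less:
  fixes \<Omega> \<Omega>' :: "'a::topological_space \<Rightarrow> real"
  assumes qsc: "quasi_strongly_causal caus"
    and intr: "intrinsic caus \<tau>"
    and cont: "continuous_on UNIV \<Omega>" "continuous_on UNIV \<Omega>'"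
    and pos: "0 < \<Omega> p"
    and eq: "tau_weighted caus \<tau> \<Omega> = tau_weighted caus \<tau> \<Omega>'"
    and less: "\<Omega> p < \<Omega>' p"
  obtains V where "p \<in> interior V" "\<And>x y. x \<in> V \<Longrightarrow> y \<in> V \<Longrightarrow> \<tau> x y = 0 \<or> \<tau> x y = \<infinity>"
proof -
  obtain C where C: "\<Omega> p < C" "C < \<Omega>' p"
    using dense[OF less] by blast
  obtain c where c: "C < c" "c < \<Omega>' p"
    using dense[OF C(2)] by blast
  have C_pos: "0 < C" and c_pos: "0 < c"
    using pos C c by linarith+
  define U where "U = {z. \<Omega> z < C} \<inter> {z. c < \<Omega>' z}"
  have "open U"
    unfolding U_def using cont by (intro open_Int open_Collect_less continuous_on_const)
  moreover have "p \<in> U"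
    using C c by (simp add: U_def)
  ultimately have "p \<in> interior U"
    by (simp add: interior_open)
  then obtain V where V: "p \<in> interior V"
    and stay: "\<And>a b \<gamma>. causal_curve caus a b \<gamma> \<Longrightarrow> \<gamma> a \<in> V \<Longrightarrow> \<gamma> b \<in> V \<Longrightarrow> \<gamma> ` {a..b} \<subseteq> U"
    using qsc unfolding quasi_strongly_causal_def by metis
  have "\<tau> x y = 0 \<or> \<tau> x y = \<infinity>" if xy: "x \<in> V" "y \<in> V" for x y
  proof -
    have in_U: "\<gamma> s \<in> U" if "causal_curve caus a b \<gamma>" "\<gamma> a = x" "\<gamma> b = y" "s \<in> {a..b}" for a b \<gamma> s
      using stay[of a b \<gamma>] that xy by blast
    have one: "tau_weighted caus \<tau> (\<lambda>_. 1) = \<tau>"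
      using intr by (simp add: intrinsic_iff_tau_weighted_one)
    have "ennreal c * \<tau> x y \<le> tau_weighted caus \<tau> \<Omega>' x y"
      using tau_weighted_mult_le[of c caus x y "\<lambda>_. 1" \<Omega>' \<tau>] in_U c_pos
      by (fastforce simp: U_def one)
    then have "ennreal (1 / C) * (ennreal c * \<tau> x y) \<le> ennreal (1 / C) * tau_weighted caus \<tau> \<Omega> x y"
      unfolding eq by (rule mult_left_mono) simp
    also have "\<dots> \<le> \<tau> x y"
      using tau_weighted_mult_le[of "1 / C" caus x y \<Omega> "\<lambda>_. 1" \<tau>] in_U C_pos
      by (fastforce simp: U_def one)
    finally have "ennreal (c / C) * \<tau> x y \<le> \<tau> x y"
      using C_pos c_pos by (simp add: mult.assoc[symmetric] ennreal_mult[symmetric])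
    moreover have "1 < c / C"
      using c C_pos by simp
    ultimately show ?thesis
    proof (cases "\<tau> x y")
      case (real r)
      then have "c / C * r \<le> 1 * r"
        using \<open>ennreal (c / C) * \<tau> x y \<le> \<tau> x y\<close> C_pos c_pos
        by (simp add: ennreal_mult'[symmetric])
      then have "r = 0"
        using \<open>1 < c / C\<close> real(1) mult_strict_right_mono[of 1 "c / C" r]
        by linarith
      with real show ?thesis
        by simp
    qed simp
  qed
  with V show thesis
    by (rule that)
qed

theorem proposition3p15:
  fixes chron caus :: "'a::metric_space \<Rightarrow> 'a \<Rightarrow> bool"
    and \<tau> :: "'a \<Rightarrow> 'a \<Rightarrow> ennreal"
    and \<Omega> \<Omega>' :: "'a \<Rightarrow> real"
  assumes "lorentzian_pre_length_space chron caus \<tau>"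
    and "quasi_strongly_causal caus"
    and "intrinsic caus \<tau>"
    and "continuous_on UNIV \<Omega>" and "\<And>x. 0 < \<Omega> x"
    and "continuous_on UNIV \<Omega>'" and "\<And>x. 0 < \<Omega>' x"
    and "tau_weighted caus \<tau> \<Omega> = tau_weighted caus \<tau> \<Omega>'"
  shows "(\<forall>p. (\<exists>s :: nat \<Rightarrow> 'a. (\<forall>n. s n \<in> chron_future chron p) \<and> s \<longlonglongrightarrow> p \<and> (\<forall>n. \<tau> p (s n) < \<infinity>))
              \<longrightarrow> \<Omega> p = \<Omega>' p) \<and>
         (\<forall>p. (\<exists>s :: nat \<Rightarrow> 'a. (\<forall>n. s n \<in> chron_past chron p) \<and> s \<longlonglongrightarrow> p \<and> (\<forall>n. \<tau> (s n) p < \<infinity>))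
              \<longrightarrow> \<Omega> p = \<Omega>' p)"
proof -
  have pos_chron: "chron x y \<Longrightarrow> \<tau> x y \<noteq> 0" for x y
    using lorentzian_pre_length_space.tau_pos_iff[OF assms(1), of x y] by simp
  \<comment> \<open>Both time directions are instances of this: put \<open>x = p\<close> or \<open>y = p\<close>.\<close>
  have agree: "\<Omega> p = \<Omega>' p"
    if near: "\<And>V. p \<in> interior V \<Longrightarrow> \<exists>x\<in>V. \<exists>y\<in>V. chron x y \<and> \<tau> x y < \<infinity>" for p
  proof (rule ccontr)
    assume "\<Omega> p \<noteq> \<Omega>' p"
    then consider "\<Omega> p < \<Omega>' p" | "\<Omega>' p < \<Omega> p"
      by linarith
    then obtain V where V: "p \<in> interior V" "\<And>x y. x \<in> V \<Longrightarrow> y \<in> V \<Longrightarrow> \<tau> x y = 0 \<or> \<tau> x y = \<infinity>"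
    proof cases
      case 1
      show thesis
        by (rule tau_degenerate_near_weight_less[OF assms(2,3,4,6,5,8) 1]) (rule that)
    next
      case 2
      show thesis
        by (rule tau_degenerate_near_weight_less[OF assms(2,3,6,4,7) assms(8)[symmetric] 2]) (rule that)
    qed
    then show False
      using near[OF V(1)] pos_chron by (metis less_irrefl)
  qed
  have tail: "\<exists>n. s n \<in> V" if "s \<longlonglongrightarrow> p" "p \<in> interior V" for s :: "nat \<Rightarrow> 'a" and p V
  proof -
    have "\<forall>\<^sub>F n in sequentially. s n \<in> interior V"
      using that by (intro topological_tendstoD) auto
    then show ?thesis
      using interior_subset by (fastforce simp: eventually_sequentially)
  qed
  show ?thesis
    unfolding chron_future_def chron_past_def
  proof (intro conjI allI impI; elim exE conjE; rule agree)
    fix p s V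
    assume "\<forall>n. s n \<in> {z. chron p z}" "s \<longlonglongrightarrow> p" "\<forall>n. \<tau> p (s n) < \<infinity>" "p \<in> interior V"
    then show "\<exists>x\<in>V. \<exists>y\<in>V. chron x y \<and> \<tau> x y < \<infinity>"
      using tail interior_subset by blast
  next
    fix p s V
    assume "\<forall>n. s n \<in> {z. chron z p}" "s \<longlonglongrightarrow> p" "\<forall>n. \<tau> (s n) p < \<infinity>" "p \<in> interior V"
    then show "\<exists>x\<in>V. \<exists>y\<in>V. chron x y \<and> \<tau> x y < \<infinity>"
      using tail interior_subset by blast
  qed
qed

end
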